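(* Let $(K,\partial)$ be a complex. If $(P,S,C)$ is a perfect HDVF for $(K,\partial)$, then $(P_q,S_q,C_q)$ is a $q$-tri-partition of $(K,\partial)$ for every dimension $q$. Conversely, if for every $q$, $(A^q,A_q,E_q)$ is a $q$-tri-partition of $(K,\partial)$, then $\big(\bigcup_q A^q,\bigcup_q A_q,\bigcup_q E_q\big)$ is a perfect HDVF for $(K,\partial)$.
   Context: Coefficients are in $\mathcal F=\mathbb{Z}/2\mathbb{Z}$. A complex $(K,\partial)$ is the chain complex of a finite cellular complex of dimension $n$: for $0\le q\le n$, $K_q$ is the $\mathcal F$-vector space with basis the finite set $\overline{K_q}$ of $q$-cells, and $\partial_q:K_q\to K_{q-1}$ is the cellular boundary map, with $\partial_q\partial_{q+1}=0$ and $\partial_0=0$. Write $K=\bigoplus_q K_q$, $\partial=\bigoplus_q\partial_q$, and $\overline K=\bigcup_q\overline{K_q}$ for the set of all cells; $\partial^\ast$ is the transpose of $\partial$ in the basis of cells. $\beta_q=\dim(\ker\partial_q/\operatorname{im}\partial_{q+1})$. For a set of cells $A$, $\mathtt i_A:\operatorname{Span}A\to K$ is the inclusion, $\mathtt j_A:K\to\operatorname{Span}A$ the coordinate projection, and $\partial_{AB}=\mathtt j_B\circ\partial\circ\mathtt i_A$. HDVF: a homological discrete vector field (HDVF) for $(K,\partial)$ is a triple $(P,S,C)$ forming a partition of $\overline K$ (parts may be empty) such that $\partial_{SP}:\operatorname{Span}S\to\operatorname{Span}P$ is invertible. It is perfect if its reduced boundary $d=\partial_{CC}-\partial_{SC}(\partial_{SP})^{-1}\partial_{CP}$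 is $0$. $P_q,S_q,C_q$ denote the sets of $q$-cells in $P,S,C$. Tri-partitions: a $q$-tree is a set $A$ of $q$-cells with $\operatorname{Span}A\cap\ker\partial=\{0\}$; a $q$-cotree is a set $A$ of $q$-cells with $\operatorname{Span}A\cap\ker\partial^\ast=\{0\}$. A $q$-tree (resp. $q$-cotree) is maximal if it is not strictly contained in another $q$-tree (resp. $q$-cotree). A $q$-tri-partition of $(K,\partial)$ is a triple $(A^q,A_q,E_q)$ forming a partition of the set of $q$-cells (parts may be empty) such that $A^q$ is a maximal $q$-cotree, $A_q$ is a maximal $q$-tree and $|E_q|=\beta_q$. *)

theory Defs
  imports "Jordan_Normal_Form.VS_Connect" "HOL-Algebra.QuotRing"
    "HOL-Library.Z2" "HOL-Library.Function_Algebras"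
begin

section \<open>Chains with coefficients in the two-element field\<close>

text \<open>The type \<^typ>\<open>bit\<close> is the field with two elements. A chain assigns a coefficient to every
  element of the type of cells; all chains used below lie in the span of a finite set of cells.\<close>

type_synonym 'c chain = "'c \<Rightarrow> bit"

definition chain_scale :: "bit \<Rightarrow> 'c chain \<Rightarrow> 'c chain" where
  "chain_scale a x = (\<lambda>c. a * x c)"

interpretation chains: vector_space "chain_scale :: bit \<Rightarrow> 'c chain \<Rightarrow> 'c chain"
  by unfold_locales (simp_all only: chain_scale_def fun_eq_iff plus_fun_apply
    distrib_left distrib_right mult.assoc mult_1_left simp_thms)

definition basis_chain :: "'c \<Rightarrow> 'c chain" where
  "basis_chain c = (\<lambda>c'. if c' = c then 1 else 0)"

definition Span :: "'c set \<Rightarrow> 'c chain set" where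
  "Span A = chains.span (basis_chain ` A)"

definition proj :: "'c set \<Rightarrow> 'c chain \<Rightarrow> 'c chain" where
  "proj A x = (\<lambda>c. if c \<in> A then x c else 0)"


section \<open>Quotient spaces and their dimension\<close>

text \<open>The same construction as \<^const>\<open>FactRing\<close>: the elements are the cosets of \<open>N\<close>. The fields
  \<open>mult\<close> and \<open>one\<close> of the record are not used for modules.\<close>

definition quotient_module ::
  "('a, 'b, 'm) module_scheme \<Rightarrow> 'b set \<Rightarrow> ('a, 'b set) module" where
  "quotient_module M N =
    \<lparr>carrier = a_rcosets\<^bsub>M\<^esub> N, mult = undefined, one = undefined, zero = N,
     add = set_add M, smult = (\<lambda>a X. \<Union>x\<in>X. N +>\<^bsub>M\<^esub> (a \<odot>\<^bsub>M\<^esub> x))\<rparr>"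

definition chain_module :: "'c chain set \<Rightarrow> (bit, 'c chain) module" where
  "chain_module V =
    \<lparr>carrier = V, mult = undefined, one = undefined, zero = 0, add = (+), smult = chain_scale\<rparr>"

lemma a_r_coset_chain_module: "a_r_coset (chain_module V) N x = (\<lambda>h. h + x) ` N"
  by (auto simp: a_r_coset_def' chain_module_def)

lemma vectorspace_quotient_module:
  assumes V: "chains.subspace V" and W: "chains.subspace W" and WV: "W \<subseteq> V"
  shows "vectorspace class_ring (quotient_module (chain_module V) W)" (is "vectorspace _ ?Q")
proof -
  define cl where "cl x = (\<lambda>h. h + x) ` W" for x
  have car: "carrier ?Q = cl ` V"
    by (auto simp: quotient_module_def A_RCOSETS_def' a_r_coset_chain_module cl_def) (auto simp: chain_module_def)
  have Wp: "a + b \<in> W" if "a \<in> W" "b \<in> W" for a b using W that chains.subspace_add by blast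
  have Wm: "a - b \<in> W" if "a \<in> W" "b \<in> W" for a b using W that chains.subspace_diff by blast
  have W0: "0 \<in> W" using W chains.subspace_0 by blast
  have Ws: "chain_scale k a \<in> W" if "a \<in> W" for a k using W that chains.subspace_scale by blast
  have cl: "y \<in> cl x \<longleftrightarrow> y - x \<in> W" for x y
    by (auto simp: cl_def image_iff) (metis diff_add_cancel)
  have add: "add ?Q (cl x) (cl y) = cl (x + y)" for x y
  proof -
    have "add ?Q (cl x) (cl y) = {a + b | a b. a \<in> cl x \<and> b \<in> cl y}"
      by (auto simp: quotient_module_def chain_module_def set_add_defs)
    also have "\<dots> = cl (x + y)"
    proof (intro Set.set_eqI iffI)
      fix z assume "z \<in> {a + b | a b. a \<in> cl x \<and> b \<in> cl y}"
      then obtain a b where z: "z = a + b" "a - x \<in> W" "b - y \<in> W" by (auto simp: cl)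
      have "z - (x + y) = (a - x) + (b - y)" by (simp only: z(1) add_diff_add)
      then show "z \<in> cl (x + y)" unfolding cl using Wp[OF z(2,3)] \<open>z - (x + y) = _\<close> by (simp only:)
    next
      fix z assume "z \<in> cl (x + y)"
      then have "z - x - y \<in> W" by (simp add: cl diff_diff_eq)
      then have "z - x \<in> cl y" "x \<in> cl x" by (simp_all only: cl diff_self W0)
      then show "z \<in> {a + b | a b. a \<in> cl x \<and> b \<in> cl y}" 
        by (intro CollectI exI[of _ x] exI[of _ "z - x"]) auto
    qed
    finally show ?thesis .
  qed
  have clW: "cl w = W" if "w \<in> W" for w
    using Wp Wm that by (auto simp: cl) (metis diff_add_cancel)
  have cl_eq: "cl x = cl y" if "x - y \<in> W" for x y
  proof -
    have "cl x = cl (y + (x - y))" by simp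
    also have "\<dots> = cl y"
      unfolding Set.set_eq_iff cl by (metis Wm Wp that add_diff_cancel_left' diff_add_cancel diff_diff_eq add.commute)
    finally show ?thesis .
  qed
  have smult: "module.smult ?Q a (cl x) = cl (chain_scale a x)" for a x
  proof -
    have "module.smult ?Q a (cl x) = (\<Union>y\<in>cl x. cl (chain_scale a y))"
      by (simp add: quotient_module_def a_r_coset_chain_module cl_def) (simp add: chain_module_def)
    also have "\<dots> = (\<Union>y\<in>cl x. cl (chain_scale a x))"
      by (intro SUP_cong refl cl_eq) (metis cl Ws chains.scale_right_diff_distrib)
    also have "\<dots> = cl (chain_scale a x)" using cl[of x x] W0 by auto
    finally show ?thesis .
  qed
  have zero: "zero ?Q = cl 0" using clW[OF W0] by (simp add: quotient_module_def)
  note Vc = chains.subspace_add[OF V] chains.subspace_0[OF V] chains.subspace_scale[OF V] chains.subspace_neg[OF V]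
  have inv: "\<exists>Y\<in>cl ` V. add ?Q Y X = zero ?Q" if X: "X \<in> cl ` V" for X
  proof -
    obtain x where x: "x \<in> V" "X = cl x" using X by auto
    then show ?thesis by (intro bexI[of _ "cl (- x)"]) (simp_all add: add zero Vc)
  qed
  have ag: "abelian_group ?Q"
  proof (rule abelian_groupI)
    show "\<exists>Y\<in>carrier ?Q. add ?Q Y X = zero ?Q" if "X \<in> carrier ?Q" for X
      using inv that by (simp only: car)
  qed (auto simp: car zero add Vc ac_simps)
  have two: "2 * x = 0" for x :: "'a chain"
    by (rule ext) simp
  have "module class_ring ?Q"
    by (rule moduleI[OF class_cring.is_cring ag])
      (auto simp: car add smult Vc two chains.scale_left_distrib[symmetric] chains.scale_right_distrib)
  then show ?thesis
    by (intro vectorspace.intro class_field)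
qed


section \<open>Complexes\<close>

text \<open>\<open>cells q\<close> is the set of \<open>q\<close>-cells and \<open>bd\<close> is the direct sum of the boundary maps. Only the
  restriction of \<open>bd\<close> to the span of the cells is constrained by the last three axioms, and only
  that restriction enters the definitions below.\<close>

locale cell_complex =
  fixes n :: nat
    and cells :: "nat \<Rightarrow> 'c set"
    and bd :: "'c chain \<Rightarrow> 'c chain"
  assumes finite_cells: "finite (cells q)"
    and no_cells_above: "q > n \<Longrightarrow> cells q = {}"
    and cells_disjoint: "p \<noteq> q \<Longrightarrow> cells p \<inter> cells q = {}"
    and linear_bd: "Vector_Spaces.linear chain_scale chain_scale bd"
    and bd_degree: "bd ` Span (cells (Suc q)) \<subseteq> Span (cells q)"
    and bd_0: "x \<in> Span (cells 0) \<Longrightarrow> bd x = 0"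
    and bd_bd: "x \<in> Span (cells (Suc (Suc q))) \<Longrightarrow> bd (bd x) = 0"

definition all_cells :: "nat \<Rightarrow> (nat \<Rightarrow> 'c set) \<Rightarrow> 'c set" where
  "all_cells n cells = (\<Union>q\<le>n. cells q)"

definition homology ::
  "(nat \<Rightarrow> 'c set) \<Rightarrow> ('c chain \<Rightarrow> 'c chain) \<Rightarrow> nat \<Rightarrow> (bit, 'c chain set) module" where
  "homology cells bd q =
    quotient_module (chain_module {x \<in> Span (cells q). bd x = 0}) (bd ` Span (cells (Suc q)))"

lemma (in cell_complex) vectorspace_homology:
  "vectorspace class_ring (homology cells bd q)"
proof -
  interpret l: Vector_Spaces.linear chain_scale chain_scale bd by (rule linear_bd)
  have 1: "chains.subspace (Span A)" for A :: "'a set" by (simp add: Span_def)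
  have "{x \<in> Span (cells q). bd x = 0} = Span (cells q) \<inter> {x. bd x = 0}" by auto
  then have 2: "chains.subspace {x \<in> Span (cells q). bd x = 0}"
    using chains.subspace_inter[OF 1 l.subspace_kernel] by (simp only:)
  show ?thesis unfolding homology_def
    by (rule vectorspace_quotient_module[OF 2 l.subspace_image[OF 1]])
      (use bd_degree bd_bd bd_0 in \<open>cases q; fastforce\<close>)
qed

definition betti :: "(nat \<Rightarrow> 'c set) \<Rightarrow> ('c chain \<Rightarrow> 'c chain) \<Rightarrow> nat \<Rightarrow> nat" where
  "betti cells bd q = vectorspace.dim class_ring (homology cells bd q)"

text \<open>The transpose of \<open>bd\<close> with respect to the basis \<open>X\<close> of all cells: the entry of the matrix
  of \<open>bd\<close> in row \<open>t\<close> and column \<open>s\<close> is \<open>bd (basis_chain s) t\<close>.\<close>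

definition cobd :: "'c set \<Rightarrow> ('c chain \<Rightarrow> 'c chain) \<Rightarrow> 'c chain \<Rightarrow> 'c chain" where
  "cobd X bd x = (\<lambda>s. if s \<in> X then \<Sum>t\<in>X. bd (basis_chain s) t * x t else 0)"

definition block :: "('c chain \<Rightarrow> 'c chain) \<Rightarrow> 'c set \<Rightarrow> 'c set \<Rightarrow> 'c chain \<Rightarrow> 'c chain" where
  "block bd A B = (\<lambda>x\<in>Span A. proj B (bd x))"

definition partition3 :: "'c set \<Rightarrow> 'c set \<Rightarrow> 'c set \<Rightarrow> 'c set \<Rightarrow> bool" where
  "partition3 X A B C \<longleftrightarrow>
    A \<union> B \<union> C = X \<and> A \<inter> B = {} \<and> A \<inter> C = {} \<and> B \<inter> C = {}"


section \<open>Homological discrete vector fields\<close>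

text \<open>In the following definitions \<open>X\<close> is the set of all cells of the complex.\<close>

definition hdvf ::
  "'c set \<Rightarrow> ('c chain \<Rightarrow> 'c chain) \<Rightarrow> 'c set \<Rightarrow> 'c set \<Rightarrow> 'c set \<Rightarrow> bool" where
  "hdvf X bd P S C \<longleftrightarrow>
    partition3 X P S C \<and> bij_betw (block bd S P) (Span S) (Span P)"

definition reduced_bd ::
  "('c chain \<Rightarrow> 'c chain) \<Rightarrow> 'c set \<Rightarrow> 'c set \<Rightarrow> 'c set \<Rightarrow> 'c chain \<Rightarrow> 'c chain" where
  "reduced_bd bd P S C = (\<lambda>x\<in>Span C.
    block bd C C x - block bd S C (inv_into (Span S) (block bd S P) (block bd C P x)))"

definition perfect_hdvf ::
  "'c set \<Rightarrow> ('c chain \<Rightarrow> 'c chain) \<Rightarrow> 'c set \<Rightarrow> 'c set \<Rightarrow> 'c set \<Rightarrow> bool" where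
  "perfect_hdvf X bd P S C \<longleftrightarrow>
    hdvf X bd P S C \<and> (\<forall>x\<in>Span C. reduced_bd bd P S C x = 0)"


section \<open>Tri-partitions\<close>

definition q_tree ::
  "nat \<Rightarrow> (nat \<Rightarrow> 'c set) \<Rightarrow> ('c chain \<Rightarrow> 'c chain) \<Rightarrow> nat \<Rightarrow> 'c set \<Rightarrow> bool" where
  "q_tree n cells bd q A \<longleftrightarrow>
    A \<subseteq> cells q \<and> Span A \<inter> {x \<in> Span (all_cells n cells). bd x = 0} = {0}"

definition q_cotree ::
  "nat \<Rightarrow> (nat \<Rightarrow> 'c set) \<Rightarrow> ('c chain \<Rightarrow> 'c chain) \<Rightarrow> nat \<Rightarrow> 'c set \<Rightarrow> bool" where
  "q_cotree n cells bd q A \<longleftrightarrow>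
    A \<subseteq> cells q \<and>
    Span A \<inter> {x \<in> Span (all_cells n cells). cobd (all_cells n cells) bd x = 0} = {0}"

definition maximal_q_tree ::
  "nat \<Rightarrow> (nat \<Rightarrow> 'c set) \<Rightarrow> ('c chain \<Rightarrow> 'c chain) \<Rightarrow> nat \<Rightarrow> 'c set \<Rightarrow> bool" where
  "maximal_q_tree n cells bd q A \<longleftrightarrow>
    q_tree n cells bd q A \<and> \<not> (\<exists>B. q_tree n cells bd q B \<and> A \<subset> B)"

definition maximal_q_cotree ::
  "nat \<Rightarrow> (nat \<Rightarrow> 'c set) \<Rightarrow> ('c chain \<Rightarrow> 'c chain) \<Rightarrow> nat \<Rightarrow> 'c set \<Rightarrow> bool" where
  "maximal_q_cotree n cells bd q A \<longleftrightarrow>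
    q_cotree n cells bd q A \<and> \<not> (\<exists>B. q_cotree n cells bd q B \<and> A \<subset> B)"

definition q_tri_partition ::
  "nat \<Rightarrow> (nat \<Rightarrow> 'c set) \<Rightarrow> ('c chain \<Rightarrow> 'c chain) \<Rightarrow> nat \<Rightarrow> 'c set \<Rightarrow> 'c set \<Rightarrow> 'c set \<Rightarrow> bool"
  where
  "q_tri_partition n cells bd q A B E \<longleftrightarrow>
    partition3 (cells q) A B E \<and>
    maximal_q_cotree n cells bd q A \<and>
    maximal_q_tree n cells bd q B \<and>
    card E = betti cells bd q"

end

theory Submission
  imports Defs
begin

text \<open>Write \<open>B\<^sub>q\<close> for the image of the \<open>(q+1)\<close>-chains under \<open>\<partial>\<close>. A set \<open>A\<close> of \<open>q\<close>-cells is a maximal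
  \<open>q\<close>-tree iff \<open>\<partial>\<close> maps \<open>Span A\<close> bijectively onto \<open>B\<^bsub>q-1\<^esub>\<close>, and, by duality, a maximal \<open>q\<close>-cotree iff the
  coordinate projection maps \<open>B\<^sub>q\<close> bijectively onto \<open>Span A\<close>. On the other side, \<open>(P, S, C)\<close> is a
  perfect HDVF iff \<open>\<partial>\<close> maps \<open>Span S\<close> bijectively onto the image of \<open>\<partial>\<close> and the projection maps that
  image bijectively onto \<open>Span P\<close>, since \<open>\<partial>\<^bsub>SP\<^esub>\<close> is the composition of these two maps.
  Both conditions can be tested one dimension at a time. The \<open>q\<close>-cycles project
  isomorphically onto \<open>Span (P\<^sub>q \<union> C\<^sub>q)\<close> and \<open>B\<^sub>q\<close> onto \<open>Span P\<^sub>q\<close>, which gives \<open>|C\<^sub>q| = \<beta>\<^sub>q\<close>.\<close>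

section \<open>Chains and coordinate projections\<close>

lemma sum_chain_apply: "(\<Sum>i\<in>I. f i) c = (\<Sum>i\<in>I. f i c)" for f :: "'i \<Rightarrow> 'c chain"
  by (induction I rule: infinite_finite_induct) simp_all

lemma subspace_Span: "chains.subspace (Span A)"
  by (simp add: Span_def)

lemma basis_chain_in_Span: "c \<in> A \<Longrightarrow> basis_chain c \<in> Span A"
  by (simp add: Span_def chains.span_base)

lemma Span_mono: "A \<subseteq> B \<Longrightarrow> Span A \<subseteq> Span B"
  by (simp add: Span_def chains.span_mono image_mono)

lemma Span_subset_subspace:
  assumes "chains.subspace V" "\<And>c. c \<in> A \<Longrightarrow> basis_chain c \<in> V"
  shows "Span A \<subseteq> V"
  unfolding Span_def using assms by (intro chains.span_minimal) auto

lemma Span_outside: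
  assumes "x \<in> Span A" "c \<notin> A"
  shows "x c = 0"
proof -
  have "Span A \<subseteq> {x. x c = 0}"
    using assms(2) by (intro Span_subset_subspace)
      (auto simp: chains.subspace_def chain_scale_def basis_chain_def)
  then show ?thesis using assms(1) by auto
qed

lemma sum_basis_chain:
  assumes "finite A"
  shows "(\<Sum>a\<in>A. chain_scale (x a) (basis_chain a)) = proj A x"
  by (rule ext)
    (simp add: sum_chain_apply chain_scale_def basis_chain_def proj_def assms if_distrib cong: if_cong)

lemma proj_in_Span: "finite A \<Longrightarrow> proj A x \<in> Span A"
  unfolding sum_basis_chain[symmetric] Span_def
  by (intro chains.span_sum chains.span_scale chains.span_base) auto

lemma proj_id: "x \<in> Span A \<Longrightarrow> proj A x = x"
  using Span_outside by (fastforce simp: proj_def)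

lemma Span_iff:
  assumes "finite A"
  shows "x \<in> Span A \<longleftrightarrow> (\<forall>c. c \<notin> A \<longrightarrow> x c = 0)"
proof
  assume "\<forall>c. c \<notin> A \<longrightarrow> x c = 0"
  then have "proj A x = x" by (auto simp: proj_def)
  then show "x \<in> Span A" using proj_in_Span[OF assms, of x] by simp
qed (simp add: Span_outside)

lemma linear_proj: "Vector_Spaces.linear chain_scale chain_scale (proj A)"
  by unfold_locales (auto simp: proj_def chain_scale_def algebra_simps)

interpretation proj: Vector_Spaces.linear chain_scale chain_scale "proj A"
  by (rule linear_proj)

lemma proj_proj: "proj A (proj B x) = proj (A \<inter> B) x"
  by (auto simp: proj_def)

lemma proj_image_Span:
  assumes "finite A"
  shows "proj A ` Span B = Span (A \<inter> B)"
proof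
  have "proj A x \<in> Span (A \<inter> B)" if "x \<in> Span B" for x
    using proj_in_Span[of "A \<inter> B" x] proj_id[OF that] proj_proj[of A B x] assms by simp
  then show "proj A ` Span B \<subseteq> Span (A \<inter> B)" by auto
  have "x \<in> proj A ` Span B" if "x \<in> Span (A \<inter> B)" for x
  proof -
    have "x \<in> Span A" "x \<in> Span B" using that Span_mono[of "A \<inter> B"] by auto
    then show ?thesis using proj_id by (metis imageI)
  qed
  then show "Span (A \<inter> B) \<subseteq> proj A ` Span B" by auto
qed

lemma Span_diff: "x \<in> Span A \<Longrightarrow> y \<in> Span A \<Longrightarrow> x - y \<in> Span A"
  using subspace_Span chains.subspace_diff by blast

text \<open>Over the field with two elements a chain is the indicator of its support, so a chain on
  \<open>A\<close> is determined by a subset of \<open>A\<close>. This later supplies finite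
  dimensionality.\<close>

lemma finite_Span: "finite A \<Longrightarrow> finite (Span A)"
proof -
  assume "finite A"
  have "x = proj {c\<in>A. x c = 1} (\<lambda>_. 1)" if "x \<in> Span A" for x
    using Span_outside[OF that] by (fastforce simp: proj_def)
  then have "Span A \<subseteq> (\<lambda>B. proj B (\<lambda>_. 1)) ` Pow A" by blast
  then show ?thesis using \<open>finite A\<close> finite_subset by blast
qed

section \<open>Orthogonality and proper subspaces\<close>

text \<open>A proper subspace is annihilated by some linear functional that is nonzero on a basis
  chain; the values of this functional on the basis chains are the coordinates of a nonzero vector
  orthogonal to \<open>W\<close>. This is the duality behind the description of cotrees.\<close>

lemma eq_Span_if_no_orthogonal:
  assumes A: "finite A" and W: "chains.subspace W" "W \<subseteq> Span A"
    and orth: "\<And>x. x \<in> Span A \<Longrightarrow> (\<And>w. w \<in> W \<Longrightarrow> (\<Sum>a\<in>A. w a * x a) = 0) \<Longrightarrow> x = 0"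
  shows "W = Span A"
proof (rule ccontr)
  assume "W \<noteq> Span A"
  then obtain t where t: "t \<in> A" "basis_chain t \<notin> W"
    using Span_subset_subspace[OF W(1), of A] W(2) by blast
  interpret vector_space_pair chain_scale chain_scale
    by unfold_locales
  obtain B where B: "B \<subseteq> W" "chains.independent B" "W = chains.span B"
    by (metis chains.basis_exists chains.span_subspace W(1))
  have "chains.independent (insert (basis_chain t) B)"
    using B t by (intro chains.independent_insertI) auto
  \<comment> \<open>The map \<open>g\<close> kills \<open>W\<close> and fixes
    \<open>basis_chain t\<close>. Its coordinate at \<open>t\<close> is the required
    functional.\<close>
  from linear_independent_extend[OF this, of "\<lambda>b. if b \<in> B then 0 else b"]
  obtain g where g: "Vector_Spaces.linear chain_scale chain_scale g"
    and gB: "\<forall>b\<in>insert (basis_chain t) B. g b = (if b \<in> B then 0 else b)" by blast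
  interpret g: Vector_Spaces.linear chain_scale chain_scale g by (rule g)
  have gW: "g w = 0" if "w \<in> W" for w
    using g.eq_0_on_span[of B w] gB that B by auto
  have gt: "g (basis_chain t) = basis_chain t"
    using gB t B(1) by auto
  \<comment> \<open>The vector representing the functional: pairing it with \<open>w\<close> gives
    \<open>g w t\<close>, which is 0 on \<open>W\<close>.\<close>
  define x where "x = proj A (\<lambda>a. g (basis_chain a) t)"
  have "(\<Sum>a\<in>A. w a * x a) = 0" if "w \<in> W" for w
  proof -
    have "w = (\<Sum>a\<in>A. chain_scale (w a) (basis_chain a))"
      using that W(2) proj_id by (fastforce simp: sum_basis_chain A)
    then have "g w t = (\<Sum>a\<in>A. chain_scale (w a) (g (basis_chain a))) t"
      by (metis (no_types, lifting) g.sum g.scale sum.cong)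
    also have "\<dots> = (\<Sum>a\<in>A. w a * x a)"
      by (auto simp: sum_chain_apply chain_scale_def x_def proj_def intro: sum.cong)
    finally show ?thesis using gW[OF that] by simp
  qed
  then have "x = 0" using orth[of x] by (simp add: x_def proj_in_Span A)
  moreover have "x t = 1" by (simp add: x_def proj_def t gt) (simp add: basis_chain_def)
  ultimately show False by simp
qed

section \<open>Dimensions\<close>

lemma vectorspace_chain_module:
  fixes V :: "'a chain set"
  assumes "chains.subspace V"
  shows "vectorspace class_ring (chain_module V)"
proof -
  note Vc = chains.subspace_add[OF assms] chains.subspace_0[OF assms]
    chains.subspace_scale[OF assms] chains.subspace_neg[OF assms]
  have "\<exists>y\<in>V. x + y = 0" if "x \<in> V" for x
    using Vc(4)[OF that] by (intro bexI[of _ "- x"]) simp_all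
  then have "abelian_group (chain_module V)"
    by (intro abelian_groupI) (auto simp: chain_module_def Vc ac_simps)
  moreover have "2 * x = 0" for x :: "'a chain"
    by (rule ext) simp
  ultimately have "module class_ring (chain_module V)"
    by (intro moduleI[OF class_cring.is_cring])
      (auto simp: chain_module_def Vc chains.scale_left_distrib[symmetric] chains.scale_right_distrib)
  then show ?thesis
    by (intro vectorspace.intro class_field)
qed

text \<open>Connects the carrier-based linear combinations behind \<open>vectorspace.dim\<close>
  with the sums behind \<open>chains.span\<close>.\<close>

lemma lincomb_chain_module:
  assumes V: "chains.subspace V" and "finite B" "B \<subseteq> V"
  shows "module.lincomb (chain_module V) a B = (\<Sum>b\<in>B. chain_scale (a b) b)"
proof -
  interpret vectorspace class_ring "chain_module V" by (rule vectorspace_chain_module[OF V])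
  show ?thesis using assms(2,3)
  proof (induction B)
    case empty
    then show ?case by (simp add: lincomb_def) (simp add: chain_module_def fun_eq_iff)
  next
    case (insert b B)
    then have "lincomb a (insert b B) = chain_scale (a b) b + lincomb a B"
      by (subst lincomb_insert2) (auto simp: chain_module_def)
    with insert show ?case by simp
  qed
qed

lemma carrier_chain_module: "carrier (chain_module V) = V"
  by (simp add: chain_module_def)

lemma dim_chain_module_Span:
  assumes "finite A"
  shows "vectorspace.dim class_ring (chain_module (Span A)) = card A"
proof -
  interpret vectorspace class_ring "chain_module (Span A)"
    by (rule vectorspace_chain_module[OF subspace_Span])
  let ?B = "basis_chain ` A"
  have inj: "inj_on basis_chain A"
    by (rule inj_onI) (metis basis_chain_def zero_neq_one)
  have B: "finite ?B" "?B \<subseteq> Span A"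
    using assms basis_chain_in_Span by auto
  have lc: "lincomb a T = (\<Sum>b\<in>T. chain_scale (a b) b)" if "T \<subseteq> ?B" for a T
    using lincomb_chain_module[OF subspace_Span, of T A a] that B finite_subset by blast
  have "basis ?B" unfolding basis_def
  proof (intro conjI)
    have "chains.independent ?B"
    proof (rule chains.independent_if_scalars_zero[OF B(1)])
      fix f x assume f: "(\<Sum>x\<in>?B. chain_scale (f x) x) = 0" and x: "x \<in> ?B"
      then obtain a where a: "a \<in> A" "x = basis_chain a" by auto
      have "(\<Sum>x\<in>?B. chain_scale (f x) x) = proj A (\<lambda>a. f (basis_chain a))"
        by (simp add: sum.reindex[OF inj] sum_basis_chain[OF assms, symmetric])
      then have "proj A (\<lambda>a. f (basis_chain a)) a = 0" using f by simp
      then show "f x = 0" using a by (simp add: proj_def)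
    qed
    \<comment> \<open>Independence in the sense of \<open>chains\<close> is carried over to
      \<open>lin_dep\<close> through \<open>lc\<close>.\<close>
    then have "a v = 0" if "finite T" "T \<subseteq> ?B" "lincomb a T = 0" "v \<in> T" for T a v
      using chains.independentD[OF _ that(1,2) _ that(4), of a] that(3) lc[OF that(2), of a] by simp
    moreover have "\<zero>\<^bsub>chain_module (Span A)\<^esub> = 0" "\<zero>\<^bsub>class_ring\<^esub> = (0 :: bit)"
      by (simp_all add: chain_module_def)
    ultimately show "lin_indpt ?B" unfolding lin_dep_def by metis
    show "gen_set ?B"
    proof
      show "span ?B \<subseteq> carrier (chain_module (Span A))"
        using B span_is_subset2 by (auto simp: chain_module_def)
      show "carrier (chain_module (Span A)) \<subseteq> span ?B"
      proof
        fix x assume "x \<in> carrier (chain_module (Span A))"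
        then have "x \<in> chains.span ?B" by (simp add: chain_module_def Span_def)
        then obtain t r where t: "finite t" "t \<subseteq> ?B" "x = (\<Sum>a\<in>t. chain_scale (r a) a)"
          unfolding chains.span_explicit by blast
        then have "x = lincomb r t" by (simp only: lc)
        then show "x \<in> span ?B"
          unfolding span_def using t by (intro CollectI exI[of _ r] exI[of _ t]) simp
      qed
    qed
    show "?B \<subseteq> carrier (chain_module (Span A))" using B by (simp add: chain_module_def)
  qed
  then show ?thesis using dim_basis[OF B(1)] card_image[OF inj] by simp
qed

text \<open>The carrier is itself a finite generating set.\<close>

lemma fin_dim_finite_carrier:
  assumes "vectorspace K V" "finite (carrier V)"
  shows "vectorspace.fin_dim K V"
proof -
  interpret vectorspace K V by (rule assms)
  show ?thesis unfolding fin_dim_def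
    using assms(2) span_is_subset2[of "carrier V"] in_own_span[of "carrier V"] by blast
qed

text \<open>The projection is a vector space isomorphism onto a space with a basis of cells. It
  turns the dimensions of cycles and boundaries into numbers of cells.\<close>

lemma dim_chain_module_eq_card:
  assumes V: "chains.subspace V" and A: "finite A" and bij: "bij_betw (proj A) V (Span A)"
  shows "vectorspace.dim class_ring (chain_module V) = card A"
proof -
  interpret V: vectorspace class_ring "chain_module V"
    by (rule vectorspace_chain_module[OF V])
  interpret W: vectorspace class_ring "chain_module (Span A)"
    by (rule vectorspace_chain_module[OF subspace_Span])
  have "proj A \<in> LinearCombinations.module_hom class_ring (chain_module V) (chain_module (Span A))"
    by (simp add: LinearCombinations.module_hom_def chain_module_def proj_in_Span A proj.add proj.scale)
  then interpret linear_map class_ring "chain_module V" "chain_module (Span A)" "proj A"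
    by unfold_locales
  have "finite V" using bij_betw_finite[OF bij] finite_Span[OF A] by simp
  then have "V.fin_dim"
    by (intro fin_dim_finite_carrier V.vectorspace_axioms) (simp add: carrier_chain_module)
  then have "V.dim = W.dim"
    using bij_betw_imp_inj_on[OF bij] bij_betw_imp_surj_on[OF bij]
    by (intro dim_eq) (simp_all only: carrier_chain_module)
  then show ?thesis by (simp only: dim_chain_module_Span[OF A])
qed

text \<open>Rank-nullity for the map sending a chain to its coset, which is onto with kernel
  \<open>W\<close>. The additive form avoids subtraction of natural numbers.\<close>

lemma dim_quotient_module:
  assumes V: "chains.subspace V" "finite V" and W: "chains.subspace W" "W \<subseteq> V"
  shows "vectorspace.dim class_ring (quotient_module (chain_module V) W)
    + vectorspace.dim class_ring (chain_module W) = vectorspace.dim class_ring (chain_module V)"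
proof -
  let ?Q = "quotient_module (chain_module V) W"
  interpret V: vectorspace class_ring "chain_module V"
    by (rule vectorspace_chain_module[OF V(1)])
  interpret Q: vectorspace class_ring ?Q
    by (rule vectorspace_quotient_module[OF V(1) W])
  let ?cl = "a_r_coset (chain_module V) W"
  note Wc = chains.subspace_add[OF W(1)] chains.subspace_diff[OF W(1)] chains.subspace_0[OF W(1)]
    chains.subspace_scale[OF W(1)]
  have mem_cl: "y \<in> ?cl x \<longleftrightarrow> y - x \<in> W" for x y
    by (auto simp: a_r_coset_chain_module image_iff) (metis diff_add_cancel)
  have cl_eq: "?cl x = ?cl y" if "x - y \<in> W" for x y
  proof -
    have "z - y = (z - x) + (x - y)" "z - x = (z - y) - (x - y)" for z
      by (simp_all only: add_diff_eq diff_diff_eq2 diff_add_cancel)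
    then show ?thesis
      unfolding Set.set_eq_iff mem_cl using Wc(1,2) that by metis
  qed
  \<comment> \<open>The subgroup structure gives access to the law \<open>S.a_rcos_sum\<close> for
    adding cosets.\<close>
  have "additive_subgroup W (chain_module V)"
  proof (intro additive_subgroup.intro V.add.subgroupI)
    fix a assume a: "a \<in> W"
    then have "\<ominus>\<^bsub>chain_module V\<^esub> a = - a"
      using chains.subspace_neg[OF W(1)] W(2)
      by (intro V.minus_equality) (auto simp: chain_module_def)
    then show "\<ominus>\<^bsub>chain_module V\<^esub> a \<in> W"
      using chains.subspace_neg[OF W(1) a] by simp
  qed (use W(2) Wc in \<open>auto simp: chain_module_def\<close>)
  then interpret S: abelian_subgroup W "chain_module V"
    by (intro abelian_subgroupI3 V.abelian_group_axioms)
  have cl0: "?cl 0 = W" by (simp add: a_r_coset_chain_module)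
  \<comment> \<open>Scalar multiplication of a coset is a union over all representatives. By
    \<open>cl_eq\<close> every term is the same coset, and the union is nonempty because
    \<open>x\<close> lies in its own coset.\<close>
  have smult: "?cl (chain_scale a x) = a \<odot>\<^bsub>?Q\<^esub> ?cl x" for a x
  proof -
    have "a \<odot>\<^bsub>?Q\<^esub> ?cl x = (\<Union>y\<in>?cl x. ?cl (chain_scale a y))"
      by (simp add: quotient_module_def) (simp add: chain_module_def)
    also have "\<dots> = (\<Union>y\<in>?cl x. ?cl (chain_scale a x))"
      by (intro SUP_cong refl cl_eq) (metis mem_cl Wc(4) chains.scale_right_diff_distrib)
    also have "\<dots> = ?cl (chain_scale a x)" using mem_cl[of x x] Wc(3) by auto
    finally show ?thesis by simp
  qed
  have car: "carrier (chain_module V) = V" "carrier ?Q = ?cl ` V" "zero ?Q = W"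
    by (auto simp: quotient_module_def A_RCOSETS_def' chain_module_def)
  have add: "add ?Q (?cl x) (?cl y) = ?cl (add (chain_module V) x y)" if "x \<in> V" "y \<in> V" for x y
    using S.a_rcos_sum[of x y] that by (simp add: quotient_module_def car)
  have sm: "module.smult (chain_module V) = chain_scale"
    by (simp add: chain_module_def)
  have hom: "?cl \<in> LinearCombinations.module_hom class_ring (chain_module V) ?Q"
    unfolding LinearCombinations.module_hom_def by (simp add: car add smult sm)
  interpret linear_map class_ring "chain_module V" ?Q ?cl
    by unfold_locales (rule hom)
  have "imT = carrier ?Q"
    by (simp only: im_def car)
  moreover have "kerT = W"
  proof -
    have "?cl x = W \<longleftrightarrow> x \<in> W" if "x \<in> V" for x
      using mem_cl[of x 0] mem_cl[of x x] cl_eq[of x 0] cl0 Wc(3) by auto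
    then show ?thesis using W(2) by (auto simp only: ker_def car)
  qed
  moreover have "V.fin_dim"
    using V(2) by (intro fin_dim_finite_carrier V.vectorspace_axioms) (simp add: carrier_chain_module)
  moreover have "V.vs W = chain_module W"
    by (simp add: chain_module_def)
  ultimately show ?thesis
    using rank_nullity by simp
qed

section \<open>Maximal projections and graded bijections\<close>

text \<open>If a nonzero \<open>z\<close> in \<open>W\<close> vanishes on \<open>A\<close>, a
  coordinate from its support can be added to \<open>A\<close> without losing surjectivity.
  Conversely, injectivity on \<open>A\<close> leaves no vector of \<open>W\<close> that could
  project to a basis chain outside \<open>A\<close> in a larger set.\<close>

lemma maximal_proj_surj_iff:
  assumes Y: "finite Y" and W: "chains.subspace W" "W \<subseteq> Span Y" and A: "A \<subseteq> Y"
  shows "proj A ` W = Span A \<and> \<not> (\<exists>A'. A' \<subseteq> Y \<and> proj A' ` W = Span A' \<and> A \<subset> A') \<longleftrightarrow>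
    bij_betw (proj A) W (Span A)" (is "?max \<longleftrightarrow> _")
proof
  assume max: ?max
  have "z = 0" if z: "z \<in> W" "proj A z = 0" for z
  proof (rule ccontr)
    assume "z \<noteq> 0"
    then obtain y where y: "z y = 1" by (auto simp: fun_eq_iff)
    then have yY: "y \<in> Y" using Span_outside[of z Y y] z(1) W(2) by auto
    have yA: "y \<notin> A" using fun_cong[OF z(2), of y] y by (auto simp: proj_def)
    have zA: "z c = 0" if "c \<in> A" for c
      using fun_cong[OF z(2), of c] that by (simp add: proj_def)
    have fin: "finite (insert y A)" using A Y finite_subset by blast
    have "w \<in> proj (insert y A) ` W" if w: "w \<in> Span (insert y A)" for w
    proof -
      have "proj A w \<in> proj A ` W" using max proj_in_Span[of A w] fin by auto
      then obtain b where b: "b \<in> W" "proj A w = proj A b" by auto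
      have bA: "w c = b c" if "c \<in> A" for c
        using fun_cong[OF b(2), of c] that by (simp add: proj_def)
      \<comment> \<open>The vector \<open>b\<close> is right on \<open>A\<close>. As
        \<open>z\<close> vanishes on \<open>A\<close> and has coefficient 1 at \<open>y\<close>,
        adding a multiple of \<open>z\<close> corrects the coordinate \<open>y\<close>
        alone.\<close>
      let ?b = "b + chain_scale (w y - b y) z"
      have "?b \<in> W"
        using b(1) z(1) W(1) by (intro chains.subspace_add chains.subspace_scale)
      moreover have "proj (insert y A) ?b = w"
        using yA y bA zA Span_outside[OF w] by (auto simp: proj_def fun_eq_iff chain_scale_def)
      ultimately show ?thesis by (metis imageI)
    qed
    then have "proj (insert y A) ` W = Span (insert y A)"
      using proj_in_Span[OF fin] by blast
    then show False using max yA yY A by (metis insert_subset insertI1 psubsetI subset_insertI)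
  qed
  then show "bij_betw (proj A) W (Span A)"
    unfolding bij_betw_def using max by (simp add: proj.inj_on_iff_eq_0[OF W(1)])
next
  assume bij: "bij_betw (proj A) W (Span A)"
  have False if A': "proj A' ` W = Span A'" "A \<subset> A'" for A'
  proof -
    obtain y where y: "y \<in> A'" "y \<notin> A" using A' by auto
    then obtain b where b: "b \<in> W" "basis_chain y = proj A' b"
      using basis_chain_in_Span[of y A'] A'(1) by auto
    \<comment> \<open>On \<open>A'\<close> the vector \<open>b\<close> is the basis chain of
      \<open>y\<close>, which is outside \<open>A\<close>; hence \<open>proj A\<close> kills
      \<open>b\<close>.\<close>
    have "proj A b = proj A (proj A' b)"
      using A'(2) by (simp add: proj_proj inf.absorb1)
    also have "\<dots> = 0"
      using y b(2)[symmetric] by (auto simp: proj_def basis_chain_def fun_eq_iff)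
    finally have "b = 0"
      using bij b(1) by (auto simp: bij_betw_def proj.inj_on_iff_eq_0[OF W(1)])
    then have "basis_chain y y = 0" using b(2) by (simp add: proj_def)
    then show False by (simp add: basis_chain_def)
  qed
  then show ?max using bij by (auto simp: bij_betw_def)
qed

text \<open>Images and preimages can be computed component by component and then summed. Separate
  families \<open>p\<close> and \<open>r\<close> allow the grading of the target to be shifted
  against that of the source, as the boundary map requires.\<close>

lemma bij_betw_graded:
  assumes f: "Vector_Spaces.linear chain_scale chain_scale f"
    and U: "chains.subspace U" and V: "chains.subspace V"
    and pU: "\<And>q u. q \<le> n \<Longrightarrow> u \<in> U \<Longrightarrow> p q u \<in> U" "\<And>u. u \<in> U \<Longrightarrow> (\<Sum>q\<le>n. p q u) = u"
    and rV: "\<And>q v. q \<le> n \<Longrightarrow> v \<in> V \<Longrightarrow> r q v \<in> V" "\<And>v. v \<in> V \<Longrightarrow> (\<Sum>q\<le>n. r q v) = v"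
    and comm: "\<And>q u. q \<le> n \<Longrightarrow> u \<in> U \<Longrightarrow> f (p q u) = r q (f u)"
  shows "bij_betw f U V \<longleftrightarrow> (\<forall>q\<le>n. bij_betw f (p q ` U) (r q ` V))"
proof (intro iffI allI impI)
  fix q assume bij: "bij_betw f U V" and q: "q \<le> n"
  have "f ` p q ` U = r q ` f ` U"
    unfolding image_image using comm[OF q] by (rule image_cong[OF refl])
  then show "bij_betw f (p q ` U) (r q ` V)"
    using bij pU(1)[OF q] unfolding bij_betw_def by (auto intro: inj_on_subset)
next
  interpret f: Vector_Spaces.linear chain_scale chain_scale f by (rule f)
  assume bij: "\<forall>q\<le>n. bij_betw f (p q ` U) (r q ` V)"
  have "inj_on f U"
  proof (rule inj_onI)
    fix u v assume uv: "u \<in> U" "v \<in> U" "f u = f v"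
    have "p q u = p q v" if "q \<le> n" for q
      using bij that uv comm[OF that] by (metis bij_betw_imp_inj_on imageI inj_onD)
    then have "(\<Sum>q\<le>n. p q u) = (\<Sum>q\<le>n. p q v)" by (intro sum.cong) auto
    then show "u = v" using uv pU(2) by simp
  qed
  moreover have "f u \<in> V" if u: "u \<in> U" for u
  proof -
    have "f u = (\<Sum>q\<le>n. f (p q u))" using pU(2)[OF u] f.sum by metis
    moreover have "f (p q u) \<in> V" if "q \<le> n" for q
    proof -
      have "f (p q u) \<in> f ` p q ` U" using u by simp
      also have "f ` p q ` U = r q ` V" using bij that by (simp add: bij_betw_def)
      finally show ?thesis using rV(1)[OF that] by auto
    qed
    ultimately show ?thesis by (auto intro!: chains.subspace_sum[OF V])
  qed
  moreover have "v \<in> f ` U" if v: "v \<in> V" for v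
  proof -
    \<comment> \<open>Preimages of the components of \<open>v\<close> are chosen separately; their
      sum is a preimage of \<open>v\<close>.\<close>
    have "\<exists>u. u \<in> U \<and> r q v = f u" if "q \<le> n" for q
      using bij that v pU(1)[OF that] unfolding bij_betw_def by blast
    then obtain u where u: "\<And>q. q \<le> n \<Longrightarrow> u q \<in> U \<and> r q v = f (u q)" by metis
    have "v = f (\<Sum>q\<le>n. u q)"
      using rV(2)[OF v] u by (simp add: f.sum)
    moreover have "(\<Sum>q\<le>n. u q) \<in> U" using u by (intro chains.subspace_sum[OF U]) auto
    ultimately show ?thesis by blast
  qed
  ultimately show "bij_betw f U V" by (auto simp: bij_betw_def)
qed

section \<open>Trees, cotrees and perfect HDVFs\<close>

context cell_complex
begin

section \<open>The boundary map on chains of mixed dimension\<close>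

abbreviation "X \<equiv> all_cells n cells"

sublocale bd: Vector_Spaces.linear chain_scale chain_scale bd
  by (rule linear_bd)

lemma finite_all_cells: "finite X"
  by (simp add: all_cells_def finite_cells)

lemma cells_subset_all_cells: "cells q \<subseteq> X"
  using no_cells_above[of q] by (cases "q \<le> n") (auto simp: all_cells_def)

lemma all_cellsE:
  assumes "c \<in> X"
  obtains q where "q \<le> n" "c \<in> cells q"
  using assms by (auto simp: all_cells_def)

lemma bd_basis_chain_in_Span: "c \<in> cells (Suc q) \<Longrightarrow> bd (basis_chain c) \<in> Span (cells q)"
  by (rule subsetD[OF bd_degree imageI[OF basis_chain_in_Span]])

lemma bd_basis_chain_0: "c \<in> cells 0 \<Longrightarrow> bd (basis_chain c) = 0"
  by (intro bd_0 basis_chain_in_Span)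

lemma bd_in_Span:
  assumes "x \<in> Span X"
  shows "bd x \<in> Span X"
proof -
  have "Span X \<subseteq> bd -` Span X"
  proof (rule Span_subset_subspace[OF bd.subspace_vimage[OF subspace_Span]])
    fix c assume "c \<in> X"
    then obtain q where q: "c \<in> cells q" by (rule all_cellsE)
    have "bd (basis_chain c) \<in> Span X"
    proof (cases q)
      case 0
      then show ?thesis
        using q bd_basis_chain_0 chains.subspace_0[OF subspace_Span] by simp
    next
      case (Suc p)
      then show ?thesis
        using q bd_basis_chain_in_Span Span_mono[OF cells_subset_all_cells] by blast
    qed
    then show "basis_chain c \<in> bd -` Span X" by simp
  qed
  then show ?thesis using assms by auto
qed

lemma bd_bd_Span:
  assumes "x \<in> Span X"
  shows "bd (bd x) = 0"
proof -
  have "Span X \<subseteq> {x. bd (bd x) = 0}"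
  proof (rule Span_subset_subspace)
    show "chains.subspace {x. bd (bd x) = 0}"
      by (auto simp: chains.subspace_def bd.add bd.scale bd.zero)
    fix c assume "c \<in> X"
    then obtain q where q: "c \<in> cells q" by (rule all_cellsE)
    \<comment> \<open>The axiom \<open>bd_bd\<close> starts in dimension 2. In dimension 1 the
      boundary is a 0-chain and \<open>bd_0\<close> applies; in dimension 0 the first boundary
      already vanishes.\<close>
    consider "q = 0" | "q = Suc 0" | m where "q = Suc (Suc m)" by (metis nat.exhaust)
    then show "basis_chain c \<in> {x. bd (bd x) = 0}"
      using q bd_basis_chain_0 bd_bd[OF basis_chain_in_Span] bd_0[OF bd_basis_chain_in_Span]
      by cases (auto simp: bd.zero)
  qed
  then show ?thesis using assms by auto
qed

text \<open>The boundary map has degree -1, and by linearity it suffices to check basis chains. For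
  a cell of dimension \<open>q + 1\<close> both projections act as the identity; for any other cell
  both sides vanish.\<close>

lemma proj_bd:
  assumes "x \<in> Span X"
  shows "proj (cells q) (bd x) = bd (proj (cells (Suc q)) x)"
proof -
  have "Span X \<subseteq> {x. proj (cells q) (bd x) = bd (proj (cells (Suc q)) x)}"
  proof (rule Span_subset_subspace)
    show "chains.subspace {x. proj (cells q) (bd x) = bd (proj (cells (Suc q)) x)}"
      by (auto simp: chains.subspace_def bd.add bd.scale bd.zero proj.add proj.scale proj.zero)
    fix c assume "c \<in> X"
    then obtain p where p: "c \<in> cells p" by (rule all_cellsE)
    have "proj (cells q) (bd (basis_chain c)) = bd (proj (cells (Suc q)) (basis_chain c))"
    proof (cases "p = Suc q")
      case True
      then show ?thesis
        using p proj_id[OF bd_basis_chain_in_Span[of c q]]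
          proj_id[OF basis_chain_in_Span[of c "cells (Suc q)"]] by simp
    next
      case False
      then have "c \<notin> cells (Suc q)" using p cells_disjoint by blast
      then have "proj (cells (Suc q)) (basis_chain c) = 0"
        by (auto simp: proj_def basis_chain_def fun_eq_iff)
      moreover have "proj (cells q) (bd (basis_chain c)) = 0"
      proof (cases p)
        case 0
        then show ?thesis using p bd_basis_chain_0 by (simp add: proj.zero)
      next
        case (Suc m)
        then have "proj (cells m) (bd (basis_chain c)) = bd (basis_chain c)"
          using p proj_id[OF bd_basis_chain_in_Span] by auto
        moreover have "cells q \<inter> cells m = {}" using False Suc by (intro cells_disjoint) auto
        ultimately show ?thesis
          using proj_proj[of "cells q" "cells m" "bd (basis_chain c)"]
          by (auto simp: proj_def fun_eq_iff)
      qed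
      ultimately show ?thesis by (simp add: bd.zero)
    qed
    then show "basis_chain c \<in> {x. proj (cells q) (bd x) = bd (proj (cells (Suc q)) x)}" by simp
  qed
  then show ?thesis using assms by auto
qed

lemma sum_proj_cells:
  assumes "x \<in> Span X"
  shows "(\<Sum>q\<le>n. proj (cells q) x) = x"
proof
  fix c
  show "(\<Sum>q\<le>n. proj (cells q) x) c = x c"
  proof (cases "c \<in> X")
    case True
    then obtain p where p: "p \<le> n" "c \<in> cells p" by (rule all_cellsE)
    have "c \<in> cells q \<longleftrightarrow> q = p" for q using p(2) cells_disjoint by blast
    then show ?thesis using p(1) by (simp add: sum_chain_apply proj_def)
  next
    case False
    then show ?thesis
      using Span_outside[OF assms False] by (simp add: sum_chain_apply proj_def)
  qed
qed

section \<open>Trees\<close>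

lemma q_tree_iff: "q_tree n cells bd q A \<longleftrightarrow> A \<subseteq> cells q \<and> inj_on bd (Span A)"
proof -
  have "Span A \<inter> {x \<in> Span X. bd x = 0} = {0} \<longleftrightarrow> (\<forall>x\<in>Span A. bd x = 0 \<longrightarrow> x = 0)"
    if "A \<subseteq> cells q"
    using Span_mono[of A X] that cells_subset_all_cells[of q] chains.subspace_0[OF subspace_Span, of A]
      bd.zero by auto
  then show ?thesis
    unfolding q_tree_def bd.inj_on_iff_eq_0[OF subspace_Span] by blast
qed

text \<open>Trees are the sets of cells with independent boundaries, so the maximal ones are those
  whose boundaries form a basis of the boundaries of all \<open>q\<close>-chains.\<close>

lemma maximal_q_tree_iff:
  "maximal_q_tree n cells bd q A \<longleftrightarrow>
    A \<subseteq> cells q \<and> bij_betw bd (Span A) (bd ` Span (cells q))"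
proof
  assume max: "maximal_q_tree n cells bd q A"
  then have A: "A \<subseteq> cells q" and inj: "inj_on bd (Span A)"
    by (auto simp: maximal_q_tree_def q_tree_iff)
  have fin: "finite A" using A finite_cells finite_subset by blast
  have "Span (cells q) \<subseteq> bd -` bd ` Span A"
  proof (rule Span_subset_subspace)
    show "chains.subspace (bd -` bd ` Span A)"
      by (intro bd.subspace_vimage bd.subspace_image subspace_Span)
    fix c assume c: "c \<in> cells q"
    show "basis_chain c \<in> bd -` bd ` Span A"
    proof (cases "c \<in> A")
      case True
      then show ?thesis using basis_chain_in_Span[of c A] by auto
    next
      case False
      then have "\<not> inj_on bd (Span (insert c A))"
        using max A c by (auto simp: maximal_q_tree_def q_tree_iff)
      then obtain x where x: "x \<in> Span (insert c A)" "bd x = 0" "x \<noteq> 0"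
        unfolding bd.inj_on_iff_eq_0[OF subspace_Span] by blast
      \<comment> \<open>The new kernel element \<open>x\<close> must involve \<open>c\<close>, as
        \<open>bd\<close> is injective on \<open>Span A\<close>. Its coefficient there is then 1, so
        subtracting \<open>x\<close> from the basis chain removes \<open>c\<close> without changing
        the boundary.\<close>
      have "x c \<noteq> 0"
      proof
        assume "x c = 0"
        then have "x \<in> Span A" using x(1) fin by (simp add: Span_iff) metis
        then show False using x inj by (auto simp: bd.inj_on_iff_eq_0[OF subspace_Span])
      qed
      then have "basis_chain c - x \<in> Span A"
        using x(1) fin by (auto simp: Span_iff basis_chain_def)
      moreover have "bd (basis_chain c - x) = bd (basis_chain c)"
        using x(2) by (simp add: bd.diff)
      ultimately show ?thesis by (metis imageI vimageI)
    qed
  qed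
  then show "A \<subseteq> cells q \<and> bij_betw bd (Span A) (bd ` Span (cells q))"
    using A inj Span_mono[OF A] unfolding bij_betw_def by auto
next
  assume A: "A \<subseteq> cells q \<and> bij_betw bd (Span A) (bd ` Span (cells q))"
  have False if B: "B \<subseteq> cells q" "inj_on bd (Span B)" "A \<subset> B" for B
  proof -
    obtain c where c: "c \<in> B" "c \<notin> A" using B by auto
    have "bd (basis_chain c) \<in> bd ` Span (cells q)"
      using c B(1) basis_chain_in_Span[of c "cells q"] by auto
    then have "bd (basis_chain c) \<in> bd ` Span A" using A by (simp add: bij_betw_def)
    then obtain a where a: "a \<in> Span A" "bd (basis_chain c) = bd a" by blast
    then have "basis_chain c = a"
      using B(2,3) c(1) Span_mono[of A B] basis_chain_in_Span[of c B] by (auto dest: inj_onD)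
    then have "basis_chain c c = 0" using Span_outside[OF a(1) c(2)] by simp
    then show False by (simp add: basis_chain_def)
  qed
  then show "maximal_q_tree n cells bd q A"
    using A by (auto simp: maximal_q_tree_def q_tree_iff bij_betw_def)
qed

section \<open>The transpose and cotrees\<close>

text \<open>The coordinate of \<open>cobd X bd x\<close> at a cell \<open>s\<close> is the pairing
  of \<open>x\<close> with the boundary of \<open>s\<close>. Only cells of dimension
  \<open>q + 1\<close> have boundaries that meet \<open>A\<close>.\<close>

lemma cobd_eq_0_iff:
  assumes A: "A \<subseteq> cells q" and x: "x \<in> Span A"
  shows "cobd X bd x = 0 \<longleftrightarrow> (\<forall>w\<in>bd ` Span (cells (Suc q)). (\<Sum>a\<in>A. w a * x a) = 0)"
proof -
  have AX: "A \<subseteq> X" using A cells_subset_all_cells by blast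
  have sum: "(\<Sum>t\<in>X. w t * x t) = (\<Sum>a\<in>A. w a * x a)" for w
    using AX Span_outside[OF x] by (intro sum.mono_neutral_right finite_all_cells) auto
  have cobd: "cobd X bd x s = (if s \<in> X then \<Sum>a\<in>A. bd (basis_chain s) a * x a else 0)" for s
    by (simp only: cobd_def sum)
  \<comment> \<open>The chains whose boundary is orthogonal to \<open>x\<close>. Being a subspace,
    it contains a span of cells once it contains their basis chains.\<close>
  let ?V = "{y. (\<Sum>a\<in>A. bd y a * x a) = 0}"
  have V: "chains.subspace ?V"
  proof (rule chains.subspaceI)
    show "0 \<in> ?V" by (simp add: bd.zero)
    show "y + z \<in> ?V" if "y \<in> ?V" "z \<in> ?V" for y z
    proof -
      have "(\<Sum>a\<in>A. bd (y + z) a * x a) = (\<Sum>a\<in>A. bd y a * x a) + (\<Sum>a\<in>A. bd z a * x a)"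
        by (simp only: bd.add plus_fun_apply distrib_right sum.distrib)
      then show ?thesis using that by simp
    qed
    show "chain_scale k y \<in> ?V" if "y \<in> ?V" for k y
    proof -
      have "(\<Sum>a\<in>A. bd (chain_scale k y) a * x a) = k * (\<Sum>a\<in>A. bd y a * x a)"
        by (simp only: bd.scale) (simp only: chain_scale_def mult.assoc sum_distrib_left)
      then show ?thesis using that by simp
    qed
  qed
  show ?thesis
  proof
    assume c: "cobd X bd x = 0"
    have "basis_chain s \<in> ?V" if "s \<in> cells (Suc q)" for s
    proof -
      have "s \<in> X" using that cells_subset_all_cells by blast
      then show ?thesis using fun_cong[OF c, of s] by (simp only: cobd if_True mem_Collect_eq zero_fun_apply)
    qed
    then have "Span (cells (Suc q)) \<subseteq> ?V" by (intro Span_subset_subspace V)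
    then show "\<forall>w\<in>bd ` Span (cells (Suc q)). (\<Sum>a\<in>A. w a * x a) = 0" by auto
  next
    assume *: "\<forall>w\<in>bd ` Span (cells (Suc q)). (\<Sum>a\<in>A. w a * x a) = 0"
    have "(\<Sum>a\<in>A. bd (basis_chain s) a * x a) = 0" if "s \<in> X" for s
    proof -
      \<comment> \<open>The cell \<open>s\<close> may have any dimension; replacing it by its part
        in dimension \<open>q + 1\<close> leaves the boundary coefficients on \<open>A\<close>
        unchanged.\<close>
      let ?w = "bd (proj (cells (Suc q)) (basis_chain s))"
      have "?w = proj (cells q) (bd (basis_chain s))"
        using proj_bd[OF basis_chain_in_Span[OF that]] by simp
      then have "bd (basis_chain s) a = ?w a" if "a \<in> A" for a
        using that A by (auto simp: proj_def)
      then have "(\<Sum>a\<in>A. bd (basis_chain s) a * x a) = (\<Sum>a\<in>A. ?w a * x a)"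
        by (intro sum.cong) auto
      also have "\<dots> = 0"
        using * proj_in_Span[OF finite_cells] by auto
      finally show ?thesis .
    qed
    then show "cobd X bd x = 0" by (intro ext) (simp only: cobd zero_fun_apply split: if_split, simp)
  qed
qed

text \<open>By \<open>cobd_eq_0_iff\<close>, a cotree is a set \<open>A\<close> for which no nonzero
  chain of \<open>Span A\<close> is orthogonal to the projected boundaries. By duality this means
  that these fill \<open>Span A\<close>.\<close>

lemma q_cotree_iff:
  "q_cotree n cells bd q A \<longleftrightarrow>
    A \<subseteq> cells q \<and> proj A ` bd ` Span (cells (Suc q)) = Span A"
proof (cases "A \<subseteq> cells q")
  case A: True
  have fin: "finite A" using A finite_cells finite_subset by blast
  let ?W = "bd ` Span (cells (Suc q))"
  have sum: "(\<Sum>a\<in>A. proj A w a * x a) = (\<Sum>a\<in>A. w a * x a)" for w x :: "'c chain"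
    by (auto simp: proj_def intro: sum.cong)
  have "q_cotree n cells bd q A \<longleftrightarrow> (\<forall>x\<in>Span A. cobd X bd x = 0 \<longrightarrow> x = 0)"
  proof -
    have "Span A \<subseteq> Span X" "0 \<in> Span A" "cobd X bd 0 = 0"
      using A cells_subset_all_cells[of q] chains.subspace_0[OF subspace_Span]
      by (auto intro!: Span_mono simp: cobd_def fun_eq_iff)
    then show ?thesis using A by (auto simp: q_cotree_def)
  qed
  also have "\<dots> \<longleftrightarrow> (\<forall>x\<in>Span A. (\<forall>w\<in>proj A ` ?W. (\<Sum>a\<in>A. w a * x a) = 0) \<longrightarrow> x = 0)"
    by (intro ball_cong refl) (simp only: cobd_eq_0_iff[OF A] ball_simps sum)
  also have "\<dots> \<longleftrightarrow> proj A ` ?W = Span A"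
  proof
    assume *: "\<forall>x\<in>Span A. (\<forall>w\<in>proj A ` ?W. (\<Sum>a\<in>A. w a * x a) = 0) \<longrightarrow> x = 0"
    show "proj A ` ?W = Span A"
    proof (rule eq_Span_if_no_orthogonal[OF fin])
      show "chains.subspace (proj A ` ?W)"
        by (intro proj.subspace_image bd.subspace_image subspace_Span)
      show "proj A ` ?W \<subseteq> Span A" using proj_in_Span[OF fin] by auto
    qed (use * in blast)
  next
    assume eq: "proj A ` ?W = Span A"
    show "\<forall>x\<in>Span A. (\<forall>w\<in>proj A ` ?W. (\<Sum>a\<in>A. w a * x a) = 0) \<longrightarrow> x = 0"
      unfolding eq
    proof (intro ballI impI ext)
      fix x c assume x: "x \<in> Span A" "\<forall>w\<in>Span A. (\<Sum>a\<in>A. w a * x a) = 0"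
      show "x c = 0 c"
      proof (cases "c \<in> A")
        case True
        \<comment> \<open>Nondegeneracy of the pairing: a basis chain reads off one
          coordinate.\<close>
        have "(\<Sum>a\<in>A. basis_chain c a * x a) = x c"
        proof -
          have "basis_chain c a * x a = (if a = c then x c else 0)" for a
            by (simp add: basis_chain_def)
          then show ?thesis using True fin by (simp only: sum.delta if_True)
        qed
        then show ?thesis using x(2) basis_chain_in_Span[OF True] by simp
      qed (use Span_outside[OF x(1)] in simp)
    qed
  qed
  finally show ?thesis using A by simp
qed (simp add: q_cotree_def)

lemma maximal_q_cotree_iff:
  "maximal_q_cotree n cells bd q A \<longleftrightarrow>
    A \<subseteq> cells q \<and> bij_betw (proj A) (bd ` Span (cells (Suc q))) (Span A)"
proof (cases "A \<subseteq> cells q")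
  case True
  show ?thesis
    unfolding maximal_q_cotree_def q_cotree_iff
    using True maximal_proj_surj_iff[OF finite_cells bd.subspace_image[OF subspace_Span] bd_degree True]
    by metis
qed (simp add: maximal_q_cotree_def q_cotree_def)

section \<open>Reduction to single dimensions\<close>

lemma bij_betw_bd_graded:
  assumes "S \<subseteq> X"
  shows "bij_betw bd (Span S) (bd ` Span X) \<longleftrightarrow>
    (\<forall>q\<le>n. bij_betw bd (Span (S \<inter> cells q)) (bd ` Span (cells q)))"
proof -
  \<comment> \<open>Boundaries are indexed by the dimension of the chains they bound:
    \<open>?r q\<close> projects to dimension \<open>q - 1\<close>, and is zero at
    \<open>q = 0\<close> because 0-chains have zero boundary.\<close>
  let ?r = "\<lambda>q. case q of 0 \<Rightarrow> (\<lambda>_. 0) | Suc p \<Rightarrow> proj (cells p)"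
  have comm: "bd (proj (cells q) x) = ?r q (bd x)" if "x \<in> Span X" for q x
    using proj_bd[OF that] bd_0[OF proj_in_Span[OF finite_cells]] by (simp split: nat.split)
  have SX: "Span S \<subseteq> Span X" using assms by (rule Span_mono)
  have im: "proj (cells q) ` Span S = Span (S \<inter> cells q)" for q
    by (simp add: proj_image_Span finite_cells Int_commute)
  have imX: "proj (cells q) ` Span X = Span (cells q)" for q
    by (simp add: proj_image_Span finite_cells cells_subset_all_cells inf.absorb1)
  have rV: "?r q ` bd ` Span X = bd ` Span (cells q)" for q
    unfolding imX[symmetric] image_image by (rule image_cong) (simp_all add: comm)
  have "bij_betw bd (Span S) (bd ` Span X) \<longleftrightarrow>
    (\<forall>q\<le>n. bij_betw bd (proj (cells q) ` Span S) (?r q ` bd ` Span X))"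
  proof (rule bij_betw_graded[OF linear_bd subspace_Span bd.subspace_image[OF subspace_Span]])
    show "proj (cells q) u \<in> Span S" if "u \<in> Span S" for q u
      using imageI[OF that, of "proj (cells q)"] Span_mono[of "S \<inter> cells q" S] by (auto simp: im)
    show "(\<Sum>q\<le>n. proj (cells q) u) = u" if "u \<in> Span S" for u
      using that SX by (intro sum_proj_cells) auto
    show "?r q v \<in> bd ` Span X" if "v \<in> bd ` Span X" for q v
      using imageI[OF that, of "?r q"] Span_mono[OF cells_subset_all_cells, of q]
      unfolding rV by auto
    \<comment> \<open>These components reach only dimensions below \<open>n\<close>. Nothing is
      lost, because \<open>v\<close> bounds some \<open>x\<close> and the sum is the boundary of the
      sum of the components of \<open>x\<close>.\<close>
    show "(\<Sum>q\<le>n. ?r q v) = v" if v: "v \<in> bd ` Span X" for v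
    proof -
      obtain x where x: "x \<in> Span X" "v = bd x" using v by auto
      have "(\<Sum>q\<le>n. ?r q v) = bd (\<Sum>q\<le>n. proj (cells q) x)"
        unfolding bd.sum x(2) by (intro sum.cong refl comm[OF x(1), symmetric])
      then show ?thesis using sum_proj_cells[OF x(1)] x(2) by simp
    qed
    show "bd (proj (cells q) u) = ?r q (bd u)" if "u \<in> Span S" for q u
      using that SX by (intro comm) auto
  qed
  then show ?thesis by (simp only: im rV)
qed

text \<open>Coordinate projections preserve dimension, so both sides carry the same grading. At
  \<open>q = n\<close> the source is zero, since there are no cells of dimension
  \<open>n + 1\<close>.\<close>

lemma bij_betw_proj_graded:
  assumes "P \<subseteq> X"
  shows "bij_betw (proj P) (bd ` Span X) (Span P) \<longleftrightarrow>
    (\<forall>q\<le>n. bij_betw (proj (P \<inter> cells q)) (bd ` Span (cells (Suc q))) (Span (P \<inter> cells q)))"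
proof -
  have finP: "finite P" using assms finite_all_cells finite_subset by blast
  have imP: "proj (cells q) ` Span P = Span (P \<inter> cells q)" for q
    by (simp add: proj_image_Span finite_cells Int_commute)
  have imX: "proj (cells q) ` Span X = Span (cells q)" for q
    by (simp add: proj_image_Span finite_cells cells_subset_all_cells inf.absorb1)
  have imB: "proj (cells q) ` bd ` Span X = bd ` Span (cells (Suc q))" for q
    unfolding imX[symmetric] image_image by (rule image_cong) (simp_all add: proj_bd)
  have "bij_betw (proj P) (bd ` Span X) (Span P) \<longleftrightarrow>
    (\<forall>q\<le>n. bij_betw (proj P) (proj (cells q) ` bd ` Span X) (proj (cells q) ` Span P))"
  proof (rule bij_betw_graded[OF linear_proj bd.subspace_image[OF subspace_Span] subspace_Span])
    show "proj (cells q) u \<in> bd ` Span X" if "u \<in> bd ` Span X" for q u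
      using imageI[OF that, of "proj (cells q)"] Span_mono[OF cells_subset_all_cells, of "Suc q"]
      unfolding imB by auto
    show "(\<Sum>q\<le>n. proj (cells q) u) = u" if "u \<in> bd ` Span X" for u
      using that bd_in_Span by (intro sum_proj_cells) auto
    show "proj (cells q) v \<in> Span P" if "v \<in> Span P" for q v
      using imageI[OF that, of "proj (cells q)"] Span_mono[of "P \<inter> cells q" P] by (auto simp: imP)
    show "(\<Sum>q\<le>n. proj (cells q) v) = v" if "v \<in> Span P" for v
      using that Span_mono[OF assms] by (intro sum_proj_cells) auto
    show "proj P (proj (cells q) u) = proj (cells q) (proj P u)" for q u
      by (simp add: proj_proj Int_commute)
  qed
  also have "\<dots> \<longleftrightarrow> (\<forall>q\<le>n. bij_betw (proj P) (bd ` Span (cells (Suc q))) (Span (P \<inter> cells q)))"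
    by (simp only: imP imB)
  \<comment> \<open>A boundary in dimension \<open>q\<close> has no coordinates outside
    \<open>cells q\<close>.\<close>
  also have "\<dots> \<longleftrightarrow> (\<forall>q\<le>n. bij_betw (proj (P \<inter> cells q)) (bd ` Span (cells (Suc q))) (Span (P \<inter> cells q)))"
  proof -
    have "proj P w = proj (P \<inter> cells q) w" if "w \<in> bd ` Span (cells (Suc q))" for q w
      using that bd_degree[of q] proj_id[of w "cells q"] proj_proj[of P "cells q" w] by auto
    then show ?thesis by (simp cong: bij_betw_cong)
  qed
  finally show ?thesis .
qed

section \<open>Perfect HDVFs in terms of boundaries\<close>

text \<open>A chain \<open>x\<close> on \<open>C\<close> can be corrected by some \<open>s\<close>
  on \<open>S\<close> so that the boundary of \<open>x - s\<close> has no \<open>P\<close>-part; its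
  \<open>C\<close>-part is then the reduced boundary of \<open>x\<close>. Perfectness forces this
  corrected boundary to vanish, whence all boundaries already come from \<open>S\<close>.\<close>

lemma perfect_hdvf_iff:
  "perfect_hdvf X bd P S C \<longleftrightarrow> partition3 X P S C \<and>
    bij_betw bd (Span S) (bd ` Span X) \<and> bij_betw (proj P) (bd ` Span X) (Span P)"
proof (cases "partition3 X P S C")
  case True
  then have sub: "P \<subseteq> X" "S \<subseteq> X" "C \<subseteq> X" by (auto simp: partition3_def)
  have fin: "finite P" "finite S" "finite C"
    using sub finite_all_cells by (auto intro: finite_subset)
  have decomp: "x = proj P x + proj S x + proj C x" if "x \<in> Span X" for x
  proof
    fix c
    show "x c = (proj P x + proj S x + proj C x) c"
      using True Span_outside[OF that, of c] by (auto simp: proj_def partition3_def)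
  qed
  let ?f = "block bd S P"
  have block: "block bd A B x = proj B (bd x)" if "x \<in> Span A" for A B x
    using that by (simp add: block_def)
  have bijf: "bij_betw ?f (Span S) (Span P) \<longleftrightarrow> bij_betw (proj P \<circ> bd) (Span S) (Span P)"
    by (rule bij_betw_cong) (simp add: block)
  have red: "\<exists>s\<in>Span S. proj P (bd (x - s)) = 0 \<and> reduced_bd bd P S C x = proj C (bd (x - s))"
    if "bij_betw ?f (Span S) (Span P)" "x \<in> Span C" for x
  proof -
    \<comment> \<open>The correction is the term to which \<open>reduced_bd\<close> applies the
      block from \<open>S\<close> to \<open>C\<close>.\<close>
    let ?s = "inv_into (Span S) ?f (block bd C P x)"
    have im: "block bd C P x \<in> ?f ` Span S"
      using that proj_in_Span[OF fin(1)] by (simp add: block bij_betw_def)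
    have s: "?s \<in> Span S" "?f ?s = block bd C P x"
      using inv_into_into[OF im] f_inv_into_f[OF im] by auto
    have "proj P (bd (x - ?s)) = 0"
      using s that(2) by (simp add: block bd.diff proj.diff)
    moreover have "reduced_bd bd P S C x = proj C (bd (x - ?s))"
      using s that(2) by (simp add: reduced_bd_def block bd.diff proj.diff)
    ultimately show ?thesis using s(1) by blast
  qed
  have "perfect_hdvf X bd P S C \<longleftrightarrow>
    bij_betw bd (Span S) (bd ` Span X) \<and> bij_betw (proj P) (bd ` Span X) (Span P)"
  proof
    assume perf: "perfect_hdvf X bd P S C"
    then have bij: "bij_betw ?f (Span S) (Span P)"
      by (simp add: perfect_hdvf_def hdvf_def)
    then have bij': "bij_betw (proj P \<circ> bd) (Span S) (Span P)" by (simp only: bijf)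
    have inj: "inj_on bd (Span S)"
      using bij' by (auto simp: bij_betw_def intro: inj_on_imageI2)
    \<comment> \<open>Chains whose boundary is also the boundary of a chain on \<open>S\<close>. The
      next steps place the spans of \<open>S\<close>, \<open>C\<close> and \<open>P\<close> in this
      subspace, in this order.\<close>
    let ?V = "bd -` bd ` Span S"
    have V: "chains.subspace ?V"
      by (intro bd.subspace_vimage bd.subspace_image subspace_Span)
    have SV: "Span S \<subseteq> ?V" by auto
    have CV: "x \<in> ?V" if x: "x \<in> Span C" for x
    proof -
      obtain s where s: "s \<in> Span S" "proj P (bd (x - s)) = 0"
          "reduced_bd bd P S C x = proj C (bd (x - s))"
        using red[OF bij x] by blast
      have xs: "x - s \<in> Span X"
        using x s(1) Span_mono[OF sub(2)] Span_mono[OF sub(3)] by (intro Span_diff) auto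
      have "proj C (bd (x - s)) = 0"
        using perf x s(3) by (simp add: perfect_hdvf_def)
      then have "bd (x - s) = proj S (bd (x - s))"
        using decomp[OF bd_in_Span[OF xs]] s(2) by simp
      then have "bd (x - s) \<in> Span S"
        using proj_in_Span[OF fin(2)] by metis
      \<comment> \<open>A boundary is a cycle, and the only cycle in \<open>Span S\<close> is
        0.\<close>
      then have "bd (x - s) = 0"
        using bd_bd_Span[OF xs] inj by (auto simp: bd.inj_on_iff_eq_0[OF subspace_Span])
      then have "bd x = bd s" by (simp add: bd.diff)
      then show ?thesis using s(1) by auto
    qed
    have PV: "x \<in> ?V" if x: "x \<in> Span P" for x
    proof -
      have "x \<in> (proj P \<circ> bd) ` Span S" using bij' x by (simp only: bij_betw_def)
      then obtain s where s: "s \<in> Span S" "x = proj P (bd s)" by auto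
      have sX: "s \<in> Span X" using s(1) Span_mono[OF sub(2)] by auto
      have "bd s \<in> ?V"
        using bd_bd_Span[OF sX] chains.subspace_0[OF subspace_Span, of S] bd.zero
        by (metis imageI vimageI)
      \<comment> \<open>Modulo \<open>S\<close> and \<open>C\<close>, a chain on \<open>P\<close> is
        a boundary, and boundaries lie in \<open>?V\<close> because their own boundary is 0.\<close>
      moreover have "x = bd s - proj S (bd s) - proj C (bd s)"
        using decomp[OF bd_in_Span[OF sX]] s(2) by (metis add_diff_cancel_right' add.commute add.assoc diff_diff_eq)
      moreover have "proj S (bd s) \<in> ?V" "proj C (bd s) \<in> ?V"
        using SV CV proj_in_Span[OF fin(2)] proj_in_Span[OF fin(3)] by blast+
      ultimately show ?thesis using chains.subspace_diff[OF V] by metis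
    qed
    have "x \<in> ?V" if "x \<in> Span X" for x
    proof -
      have "proj P x + proj S x + proj C x \<in> ?V"
        by (intro chains.subspace_add[OF V] PV[OF proj_in_Span] subsetD[OF SV proj_in_Span]
          CV[OF proj_in_Span] fin)
      then show ?thesis using decomp[OF that] by metis
    qed
    then have im: "bd ` Span S = bd ` Span X"
      using Span_mono[OF sub(2)] by auto
    then have bd: "bij_betw bd (Span S) (bd ` Span X)"
      using inj by (simp add: bij_betw_def)
    then show "bij_betw bd (Span S) (bd ` Span X) \<and> bij_betw (proj P) (bd ` Span X) (Span P)"
      using bij' bij_betw_comp_iff[OF bd, of "proj P" "Span P"] by blast
  next
    assume bij: "bij_betw bd (Span S) (bd ` Span X) \<and> bij_betw (proj P) (bd ` Span X) (Span P)"
    then have f: "bij_betw ?f (Span S) (Span P)"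
      unfolding bijf by (blast intro: bij_betw_trans)
    have "reduced_bd bd P S C x = 0" if x: "x \<in> Span C" for x
    proof -
      obtain s where s: "s \<in> Span S" "proj P (bd (x - s)) = 0"
          "reduced_bd bd P S C x = proj C (bd (x - s))"
        using red[OF f x] by blast
      have "x - s \<in> Span X"
        using x s(1) Span_mono[OF sub(2)] Span_mono[OF sub(3)] by (intro Span_diff) auto
      \<comment> \<open>A boundary without \<open>P\<close>-part is 0, as \<open>proj P\<close> is
        injective on boundaries.\<close>
      then have "bd (x - s) = 0"
        using s(2) bij proj.inj_on_iff_eq_0[OF bd.subspace_image[OF subspace_Span]]
        by (simp add: bij_betw_def)
      then show ?thesis using s(3) by (simp add: proj.zero)
    qed
    then show "perfect_hdvf X bd P S C"
      using True f by (simp add: perfect_hdvf_def hdvf_def)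
  qed
  then show ?thesis using True by simp
qed (simp add: perfect_hdvf_def hdvf_def)

section \<open>Critical cells and Betti numbers\<close>

lemma card_eq_betti:
  assumes part: "partition3 (cells q) P S C"
    and S: "bij_betw bd (Span S) (bd ` Span (cells q))"
    and P: "bij_betw (proj P) (bd ` Span (cells (Suc q))) (Span P)"
  shows "card C = betti cells bd q"
proof -
  let ?Z = "{x \<in> Span (cells q). bd x = 0}" and ?B = "bd ` Span (cells (Suc q))"
  have sub: "P \<subseteq> cells q" "S \<subseteq> cells q" "C \<subseteq> cells q"
    using part by (auto simp: partition3_def)
  have fin: "finite P" "finite S" "finite C"
    using sub finite_cells by (auto intro: finite_subset)
  have Z: "chains.subspace ?Z"
    using chains.subspace_inter[OF subspace_Span bd.subspace_kernel, of "cells q"]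
    by (simp add: Int_def)
  have B: "chains.subspace ?B"
    by (intro bd.subspace_image subspace_Span)
  have BZ: "?B \<subseteq> ?Z"
    using bd_degree[of q] bd_bd_Span Span_mono[OF cells_subset_all_cells, of "Suc q"] by auto
  have "bij_betw (proj (P \<union> C)) ?Z (Span (P \<union> C))"
    unfolding bij_betw_def
  proof
    have "z = 0" if z: "z \<in> ?Z" "proj (P \<union> C) z = 0" for z
    proof -
      have "z c = 0" if "c \<notin> S" for c
        using fun_cong[OF z(2), of c] that part Span_outside[of z "cells q" c] z(1)
        by (cases "c \<in> cells q") (auto simp: proj_def partition3_def split: if_splits)
      \<comment> \<open>A cycle that vanishes on \<open>P\<close> and \<open>C\<close> is supported
        on \<open>S\<close>, where \<open>bd\<close> is injective.\<close>
      then have "z \<in> Span S" by (simp add: Span_iff fin)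
      then show ?thesis
        using z(1) S by (simp add: bij_betw_def bd.inj_on_iff_eq_0[OF subspace_Span])
    qed
    then show "inj_on (proj (P \<union> C)) ?Z"
      by (simp add: proj.inj_on_iff_eq_0[OF Z])
    have "w \<in> proj (P \<union> C) ` ?Z" if w: "w \<in> Span (P \<union> C)" for w
    proof -
      have wq: "w \<in> Span (cells q)" using w Span_mono[of "P \<union> C" "cells q"] sub by auto
      \<comment> \<open>Every \<open>q\<close>-chain has the boundary of some \<open>s\<close> on
        \<open>S\<close>. Subtracting \<open>s\<close> makes \<open>w\<close> a cycle and does not
        affect its coordinates on \<open>P\<close> and \<open>C\<close>.\<close>
      then have "bd w \<in> bd ` Span S" using S by (simp add: bij_betw_def)
      then obtain s where s: "s \<in> Span S" "bd w = bd s" by auto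
      have "w - s \<in> ?Z"
        using wq s Span_mono[OF sub(2)] Span_diff[of w "cells q" s] by (auto simp: bd.diff)
      moreover have "s c = 0" if "c \<in> P \<union> C" for c
        using that part by (intro Span_outside[OF s(1)]) (auto simp: partition3_def)
      then have "proj (P \<union> C) s = 0"
        by (auto simp: proj_def fun_eq_iff)
      then have "proj (P \<union> C) (w - s) = w"
        using proj_id[OF w] by (simp add: proj.diff)
      ultimately show ?thesis by (metis imageI)
    qed
    then show "proj (P \<union> C) ` ?Z = Span (P \<union> C)"
      using proj_in_Span[of "P \<union> C"] fin by auto
  qed
  then have "vectorspace.dim class_ring (chain_module ?Z) = card (P \<union> C)"
    using fin by (intro dim_chain_module_eq_card Z) auto
  moreover have "vectorspace.dim class_ring (chain_module ?B) = card P"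
    by (intro dim_chain_module_eq_card B fin P)
  moreover have "finite ?Z" using finite_Span[OF finite_cells, of q] by simp
  ultimately have "betti cells bd q + card P = card (P \<union> C)"
    using dim_quotient_module[OF Z _ B BZ] by (simp only: betti_def homology_def)
  moreover have "card (P \<union> C) = card P + card C"
    using part fin by (intro card_Un_disjoint) (auto simp: partition3_def)
  ultimately show ?thesis by simp
qed

end

section \<open>Passing between the whole complex and its dimensions\<close>

theorem proposition4:
  fixes n :: nat
    and cells :: "nat \<Rightarrow> 'c set"
    and bd :: "'c chain \<Rightarrow> 'c chain"
  assumes "cell_complex n cells bd"
  shows "(\<forall>P S C. perfect_hdvf (all_cells n cells) bd P S C \<longrightarrow>
            (\<forall>q\<le>n. q_tri_partition n cells bd q (P \<inter> cells q) (S \<inter> cells q) (C \<inter> cells q))) \<and>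
         (\<forall>Aup Alow E :: nat \<Rightarrow> 'c set.
            (\<forall>q\<le>n. q_tri_partition n cells bd q (Aup q) (Alow q) (E q)) \<longrightarrow>
            perfect_hdvf (all_cells n cells) bd (\<Union>q\<le>n. Aup q) (\<Union>q\<le>n. Alow q) (\<Union>q\<le>n. E q))"
proof (intro conjI allI impI)
  interpret cell_complex n cells bd by (rule assms)
  {
    fix P S C q assume perf: "perfect_hdvf X bd P S C" and q: "q \<le> n"
    then have part: "partition3 X P S C"
      by (simp add: perfect_hdvf_iff)
    then have "P \<subseteq> X" "S \<subseteq> X"
      unfolding partition3_def by blast+
    then have P: "bij_betw (proj (P \<inter> cells q)) (bd ` Span (cells (Suc q))) (Span (P \<inter> cells q))"
      and S: "bij_betw bd (Span (S \<inter> cells q)) (bd ` Span (cells q))"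
      using perf q by (simp_all add: perfect_hdvf_iff bij_betw_bd_graded bij_betw_proj_graded)
    have part_q: "partition3 (cells q) (P \<inter> cells q) (S \<inter> cells q) (C \<inter> cells q)"
      using part cells_subset_all_cells[of q] unfolding partition3_def by blast
    show "q_tri_partition n cells bd q (P \<inter> cells q) (S \<inter> cells q) (C \<inter> cells q)"
      unfolding q_tri_partition_def maximal_q_cotree_iff maximal_q_tree_iff
      using part_q P S card_eq_betti[OF part_q S P] by simp
  next
    fix Aup Alow E :: "nat \<Rightarrow> 'c set"
    assume tri: "\<forall>q\<le>n. q_tri_partition n cells bd q (Aup q) (Alow q) (E q)"
    have part: "partition3 (cells q) (Aup q) (Alow q) (E q)" if "q \<le> n" for q
      using tri that by (simp add: q_tri_partition_def)
    \<comment> \<open>Since cells of different dimensions are disjoint, each member of the family is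
      recovered from the union; this lets the graded criteria be applied to unions.\<close>
    have restrict: "(\<Union>q\<le>n. F q) \<inter> cells p = F p"
      if p: "p \<le> n" and F: "\<And>q. q \<le> n \<Longrightarrow> F q \<subseteq> cells q" for F p
    proof -
      have "q = p" if "x \<in> F q" "x \<in> cells p" "q \<le> n" for x q
        using F[OF that(3)] that(1,2) cells_disjoint[of q p] by auto
      then show ?thesis using p F[OF p] by auto
    qed
    have sub: "Aup q \<subseteq> cells q" "Alow q \<subseteq> cells q" "E q \<subseteq> cells q" if "q \<le> n" for q
      using part[OF that] by (auto simp: partition3_def)
    have disj: "(\<Union>q\<le>n. F q) \<inter> (\<Union>q\<le>n. G q) = {}"
      if F: "\<And>q. q \<le> n \<Longrightarrow> F q \<subseteq> cells q" and G: "\<And>q. q \<le> n \<Longrightarrow> G q \<subseteq> cells q"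
        and FG: "\<And>q. q \<le> n \<Longrightarrow> F q \<inter> G q = {}" for F G
    proof -
      \<comment> \<open>Within \<open>cells q\<close> the union of the \<open>G p\<close> is just
        \<open>G q\<close>, so disjointness need only be known dimension by dimension.\<close>
      have "F q \<inter> (\<Union>p\<le>n. G p) = {}" if q: "q \<le> n" for q
        using restrict[OF q, of G] F[OF q] G FG[OF q] by auto
      then show ?thesis by auto
    qed
    have "(\<Union>q\<le>n. Aup q) \<union> (\<Union>q\<le>n. Alow q) \<union> (\<Union>q\<le>n. E q)
        = (\<Union>q\<le>n. Aup q \<union> Alow q \<union> E q)"
      by auto
    also have "\<dots> = X"
      unfolding all_cells_def using part by (intro SUP_cong refl) (simp add: partition3_def)
    finally have un: "(\<Union>q\<le>n. Aup q) \<union> (\<Union>q\<le>n. Alow q) \<union> (\<Union>q\<le>n. E q) = X" .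
    then have "partition3 X (\<Union>q\<le>n. Aup q) (\<Union>q\<le>n. Alow q) (\<Union>q\<le>n. E q)"
      unfolding partition3_def using part sub
      by (intro conjI disj) (simp_all add: partition3_def)
    moreover have "bij_betw bd (Span (\<Union>q\<le>n. Alow q)) (bd ` Span X)"
    proof (subst bij_betw_bd_graded)
      show "\<forall>p\<le>n. bij_betw bd (Span ((\<Union>q\<le>n. Alow q) \<inter> cells p)) (bd ` Span (cells p))"
        using tri by (simp add: restrict[OF _ sub(2)] q_tri_partition_def maximal_q_tree_iff)
    qed (use un in blast)
    moreover have "bij_betw (proj (\<Union>q\<le>n. Aup q)) (bd ` Span X) (Span (\<Union>q\<le>n. Aup q))"
    proof (subst bij_betw_proj_graded)
      show "\<forall>p\<le>n. bij_betw (proj ((\<Union>q\<le>n. Aup q) \<inter> cells p)) (bd ` Span (cells (Suc p)))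
          (Span ((\<Union>q\<le>n. Aup q) \<inter> cells p))"
        using tri by (simp add: restrict[OF _ sub(1)] q_tri_partition_def maximal_q_cotree_iff)
    qed (use un in blast)
    ultimately show "perfect_hdvf X bd (\<Union>q\<le>n. Aup q) (\<Union>q\<le>n. Alow q) (\<Union>q\<le>n. E q)"
      unfolding perfect_hdvf_iff by blast
  }
qed

end
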